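(* Let $K:=\min_{x>1}\frac{16x^2}{1-x+x\ln x}\approx 98.8249\ldots$. For any $\varepsilon>0$ there exists $n_\varepsilon\in\mathbb N$ such that $\mathrm{R}(\vec{\mathcal T}_n)<(K+\varepsilon)\,n^4\ln n$ for all $n\ge n_\varepsilon$. Consequently, $\mathrm{R}(\vec{\mathcal T}_n)<99\,n^4\ln n$ for all sufficiently large $n$.
   Context: Graphs are simple and undirected. A digraph has neither loops nor pairs of opposite arcs. An orientation $\vec G$ of a graph $G$ is a digraph on $V_G$ obtained by replacing each edge $\{a,b\}$ by exactly one of $(a,b)$, $(b,a)$. For a graph $G$ and a digraph $\vec H$, $G\to\vec H$ means: for every orientation $\vec G$ of $G$ there is an injective map $f:V_{\vec H}\to V_G$ such that for all $u,v\in V_{\vec H}$, $(u,v)\in E_{\vec H}$ if and only if $(f(u),f(v))\in E_{\vec G}$ (an induced copy). For a class $\vec{\mathcal H}$ of digraphs, $G\to\vec{\mathcal H}$ means $G\to\vec H$ for every $\vec H\in\vec{\mathcal H}$, and $\mathrm{R}(\vec{\mathcal H})$ is the smallest number of vertices of a graph $G$ with $G\to\vec{\mathcal H}$. $\vec{\mathcal T}_n$ denotes the class of all oriented trees (orientations of trees) on $n$ vertices. *)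

theory Defs
  imports
    Complex_Main
    "HOL-Library.Extended_Real"
    "Graph_Theory.Graph_Theory"
begin

text \<open>
  Finite simple undirected graphs are the symmetric loop-free digraphs of \<^locale>\<open>pair_graph\<close>:
  an edge \<open>{a,b}\<close> is the pair of opposite arcs \<open>(a,b)\<close> and \<open>(b,a)\<close>.
\<close>

definition orientation_of :: "'a pair_pre_digraph \<Rightarrow> 'a pair_pre_digraph \<Rightarrow> bool" where
  "orientation_of D G \<longleftrightarrow>
     pverts D = pverts G \<and> parcs D \<subseteq> parcs G \<and>
     (\<forall>a b. (a, b) \<in> parcs G \<longrightarrow> ((a, b) \<in> parcs D) \<noteq> ((b, a) \<in> parcs D))"

definition induced_copy :: "('b \<Rightarrow> 'a) \<Rightarrow> 'b pair_pre_digraph \<Rightarrow> 'a pair_pre_digraph \<Rightarrow> bool" where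
  "induced_copy f H D \<longleftrightarrow>
     inj_on f (pverts H) \<and> f ` pverts H \<subseteq> pverts D \<and>
     (\<forall>u\<in>pverts H. \<forall>v\<in>pverts H. (u, v) \<in> parcs H \<longleftrightarrow> (f u, f v) \<in> parcs D)"

definition arrows :: "'a pair_pre_digraph \<Rightarrow> 'b pair_pre_digraph \<Rightarrow> bool" where
  "arrows G H \<longleftrightarrow> (\<forall>D. orientation_of D G \<longrightarrow> (\<exists>f. induced_copy f H D))"

definition arrows_class :: "'a pair_pre_digraph \<Rightarrow> 'b pair_pre_digraph set \<Rightarrow> bool" where
  "arrows_class G \<H> \<longleftrightarrow> (\<forall>H\<in>\<H>. arrows G H)"

text \<open>
  Every finite graph is isomorphic to one whose vertices are natural numbers, so vertices
  of type \<^typ>\<open>nat\<close> are no restriction.  The value is \<^term>\<open>\<infinity> :: enat\<close> if no such graph exists;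
  otherwise the infimum is attained, as \<^typ>\<open>enat\<close> is well-ordered.
\<close>

definition oriented_ramsey :: "'b pair_pre_digraph set \<Rightarrow> enat" where
  "oriented_ramsey \<H> =
     (INF G \<in> {G :: nat pair_pre_digraph. pair_graph G \<and> arrows_class G \<H>}. enat (card (pverts G)))"

text \<open>
  The predicate \<^const>\<open>tree\<close> of the library is not what is wanted here: it forbids directed cycles,
  and in a symmetric digraph \<open>a, b, a\<close> is one.  The cycles of an undirected graph are the
  directed cycles of length at least 3 of the corresponding symmetric digraph.
\<close>

definition undirected_tree :: "'a pair_pre_digraph \<Rightarrow> bool" where
  "undirected_tree G \<longleftrightarrow>
     pair_graph G \<and> Digraph_Component.connected (with_proj G) \<and>
     \<not> (\<exists>p. pre_digraph.cycle (with_proj G) p \<and> 3 \<le> length p)"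

definition oriented_tree :: "'a pair_pre_digraph \<Rightarrow> bool" where
  "oriented_tree T \<longleftrightarrow> (\<exists>G. undirected_tree G \<and> orientation_of T G)"

definition oriented_trees :: "nat \<Rightarrow> nat pair_pre_digraph set" where
  "oriented_trees n = {T. oriented_tree T \<and> card (pverts T) = n}"

definition K_fun :: "real \<Rightarrow> real" where
  "K_fun x = 16 * x\<^sup>2 / (1 - x + x * ln x)"

definition K_const :: real where
  "K_const = (INF x\<in>{1<..}. K_fun x)"

end

theory Submission
  imports
    Defs
    "HOL-Analysis.Harmonic_Numbers"
    "HOL-Real_Asymp.Real_Asymp"
begin

text \<open>
  Take a random graph on \<open>N\<close> vertices with edge probability \<open>p\<close> of order \<open>n\<^sup>-\<^sup>2\<close>.
  By a Chernoff bound any two vertices have at most \<open>5Np\<^sup>2\<close> common neighbours, and all large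
  vertex sets have about the expected number of edges, so that in every orientation a set in which
  all out-degrees (or all in-degrees) are at most \<open>d\<close> has size at most about \<open>2d/p\<close>.
  Given an oriented tree with a leaf \<open>v\<close> attached to \<open>a\<close>, delete from the current vertex set
  the vertices whose degree in the direction of the leaf is too small, embed the tree without
  \<open>v\<close> into the remaining vertices, and choose the image of \<open>v\<close> among the many neighbours of the
  image of \<open>a\<close>, avoiding the few that are adjacent to another vertex of the copy.  The deleted
  sets for trees with \<open>k < n\<close> vertices have size about \<open>2k \<cdot> 5Np\<^sup>2/p\<close> each, about
  \<open>5n\<^sup>2Np\<close> in total, which is less than \<open>N\<close> if \<open>p < 1/(5n\<^sup>2)\<close>.  As the sum over \<open>k\<close> gains a
  factor of 2, \<open>98 n\<^sup>4 ln n\<close> vertices are enough, and \<open>98 < K < 99\<close>.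
\<close>

section \<open>The constant\<close>

text \<open>Serves two purposes: the minimiser of \<open>K_fun\<close> lies close to 5, and the
  codegree estimate for the random graph is a Chernoff bound with base 5.\<close>

lemma ln_5_bounds: "1.60943789 \<le> ln (5 :: real)" "ln (5 :: real) \<le> 1.60943793"
  using ln_approx_bounds[of 5 20] by (simp_all add: eval_nat_numeral)

text \<open>The critical equation of \<open>K_fun\<close> is x ln x = 2(x - 1), and these two points
  enclose its solution. Since ln x = ln 5 - ln (5/x) with 5/x close to 1, very few terms of the
  series for the second logarithm suffice.\<close>

lemma ln_sign_change:
  shows "ln (4.9215525 :: real) \<le> 2 * (4.9215525 - 1) / 4.9215525"
    and "2 * (4.921556 - 1) / 4.921556 \<le> ln (4.921556 :: real)"
proof -
  have upper: "ln x \<le> a - b" if "0 < x" "ln 5 \<le> a" "b \<le> ln (5 / x)" for a b x :: real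
    using that by (simp add: ln_div)
  have lower: "a - b \<le> ln x" if "0 < x" "a \<le> ln 5" "ln (5 / x) \<le> b" for a b x :: real
    using that by (simp add: ln_div)
  have "0.0158138 \<le> ln (5 / 4.9215525 :: real)"
    using ln_approx_bounds[of "5 / 4.9215525" 2] by (simp add: eval_nat_numeral)
  then have "ln (4.9215525 :: real) \<le> 1.60943793 - 0.0158138"
    by (intro upper[OF _ ln_5_bounds(2)]) simp
  then show "ln (4.9215525 :: real) \<le> 2 * (4.9215525 - 1) / 4.9215525"
    by simp
  have "ln (5 / 4.921556 :: real) \<le> 0.0158132"
    using ln_approx_bounds[of "5 / 4.921556" 2] by (simp add: eval_nat_numeral)
  then have "1.60943789 - 0.0158132 \<le> ln (4.921556 :: real)"
    by (intro lower[OF _ ln_5_bounds(1)]) simp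
  then show "2 * (4.921556 - 1) / 4.921556 \<le> ln (4.921556 :: real)"
    by simp
qed

text \<open>Up to a positive factor, 2(1 - 1/y) - ln y is the derivative of 1/\<open>K_fun\<close>.
  It vanishes at 1, increases up to 2 and decreases afterwards, so a zero beyond 2 is its only
  change of sign on y > 1.\<close>

lemma K_derivative_sign:
  fixes x\<^sub>0 :: real
  assumes "2 < x\<^sub>0" "x\<^sub>0 * ln x\<^sub>0 = 2 * (x\<^sub>0 - 1)"
  shows "1 < y \<Longrightarrow> y \<le> x\<^sub>0 \<Longrightarrow> 0 \<le> 2 * (1 - 1 / y) - ln y"
    and "x\<^sub>0 \<le> y \<Longrightarrow> 2 * (1 - 1 / y) - ln y \<le> 0"
proof -
  define \<phi> where "\<phi> y = 2 * (1 - 1 / y) - ln y" for y :: real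
  have deriv: "(\<phi> has_real_derivative (2 - y) / y\<^sup>2) (at y)" if "0 < y" for y
    unfolding \<phi>_def using that
    by (auto intro!: derivative_eq_intros simp: field_simps power2_eq_square)
  have zero: "\<phi> 1 = 0" "\<phi> x\<^sub>0 = 0"
    using assms by (simp_all add: \<phi>_def field_simps)
  have decr: "\<phi> b \<le> \<phi> a" if "2 \<le> a" "a \<le> b" for a b
    using that by (intro DERIV_nonpos_imp_nonincreasing[of a b \<phi>]) (auto intro!: exI deriv simp: divide_simps)
  have incr: "\<phi> a \<le> \<phi> b" if "1 \<le> a" "a \<le> b" "b \<le> 2" for a b
    using that by (intro DERIV_nonneg_imp_nondecreasing[of a b \<phi>]) (auto intro!: exI deriv)
  show "0 \<le> 2 * (1 - 1 / y) - ln y" if "1 < y" "y \<le> x\<^sub>0"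
    using incr[of 1 y] decr[of y x\<^sub>0] that zero by (cases "y \<le> 2") (auto simp: \<phi>_def)
  show "2 * (1 - 1 / y) - ln y \<le> 0" if "x\<^sub>0 \<le> y"
    using decr[of x\<^sub>0 y] that zero assms(1) by (auto simp: \<phi>_def)
qed

text \<open>This is x times the strict form of ln t <= t - 1 at t = 1/x, which differs from
  1.\<close>

lemma K_denominator_pos:
  fixes x :: real
  assumes "1 < x"
  shows "0 < 1 - x + x * ln x"
proof -
  have "ln (1 / x) < 1 / x - 1"
    using assms ln_le_minus_one[of "1 / x"] ln_eq_minus_one[of "1 / x"] by (cases "ln (1 / x) = 1 / x - 1") auto
  then show ?thesis
    using assms by (simp add: ln_div field_simps)
qed

text \<open>Maximising the reciprocal is easier: f = 16/\<open>K_fun\<close> increases up to the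
  critical point and decreases after it.\<close>

lemma K_fun_minimum:
  assumes "2 < x\<^sub>0" "x\<^sub>0 * ln x\<^sub>0 = 2 * (x\<^sub>0 - 1)" "1 < y"
  shows "K_fun x\<^sub>0 \<le> K_fun y"
proof -
  define f where "f y = (1 - y + y * ln y) / y\<^sup>2" for y :: real
  have deriv: "(f has_real_derivative (2 * (1 - 1 / y) - ln y) / y\<^sup>2) (at y)" if "0 < y" for y
    unfolding f_def using that
    by (auto intro!: derivative_eq_intros simp: field_simps power2_eq_square)
  have "f y \<le> f x\<^sub>0"
  proof (cases "y \<le> x\<^sub>0")
    case True
    show ?thesis
    proof (rule DERIV_nonneg_imp_nondecreasing[of y x\<^sub>0 f])
      show "\<exists>d. (f has_real_derivative d) (at z) \<and> 0 \<le> d" if "y \<le> z" "z \<le> x\<^sub>0" for z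
        using deriv[of z] K_derivative_sign(1)[OF assms(1,2), of z] that assms(3)
        by (intro exI[of _ "(2 * (1 - 1 / z) - ln z) / z\<^sup>2"]) simp
    qed (rule True)
  next
    case False
    show ?thesis
    proof (rule DERIV_nonpos_imp_nonincreasing[of x\<^sub>0 y f])
      show "\<exists>d. (f has_real_derivative d) (at z) \<and> d \<le> 0" if "x\<^sub>0 \<le> z" "z \<le> y" for z
        using deriv[of z] K_derivative_sign(2)[OF assms(1,2), of z] that assms(1)
        by (intro exI[of _ "(2 * (1 - 1 / z) - ln z) / z\<^sup>2"]) (simp add: divide_nonpos_nonneg)
    qed (use False in simp)
  qed
  moreover have "0 < f y"
    using assms K_denominator_pos[of y] by (simp add: f_def)
  moreover have "K_fun z = 16 / f z" for z
    by (simp add: K_fun_def f_def)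
  ultimately show ?thesis
    by (simp add: frac_le)
qed

lemma K_const_minimum:
  shows "\<exists>x>1. K_fun x = K_const \<and> (\<forall>y>1. K_const \<le> K_fun y)"
    and "\<bar>K_const - 98.8249\<bar> < 0.00005"
proof -
  have "\<exists>x\<ge>4.9215525. x \<le> 4.921556 \<and> x * ln x - 2 * (x - 1) = (0 :: real)"
    using ln_sign_change by (intro IVT') (auto intro!: continuous_intros simp: field_simps)
  then obtain x\<^sub>0 :: real where x0: "4.9215525 \<le> x\<^sub>0" "x\<^sub>0 \<le> 4.921556" "x\<^sub>0 * ln x\<^sub>0 = 2 * (x\<^sub>0 - 1)"
    by auto
  have min: "K_fun x\<^sub>0 \<le> K_fun y" if "1 < y" for y
    using x0 that by (intro K_fun_minimum) auto
  then have K: "K_const = K_fun x\<^sub>0"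
    unfolding K_const_def using x0 by (intro cInf_eq_minimum) auto
  show "\<exists>x>1. K_fun x = K_const \<and> (\<forall>y>1. K_const \<le> K_fun y)"
    using min x0 K by (intro exI[of _ x\<^sub>0]) auto
  \<comment> \<open>The critical equation turns the denominator 1 - x + x ln x into x - 1, which
    removes the logarithm.\<close>
  have K': "K_const = 16 * x\<^sub>0\<^sup>2 / (x\<^sub>0 - 1)"
    using x0(3) by (simp add: K K_fun_def algebra_simps)
  \<comment> \<open>Expanded, the product says that 16x^2 - c(x - 1), with c the claimed lower
    bound, is at least its value at the left end of the enclosing interval, and that value is
    nonnegative. The upper bound uses the right end in the same way.\<close>
  have "0 \<le> (x\<^sub>0 - 4.9215525) * (16 * (x\<^sub>0 + 4.9215525) - 98.824855)"
    using x0 by (intro mult_nonneg_nonneg) auto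
  then have "98.824855 \<le> K_const"
    using x0 by (simp add: K' field_simps power2_eq_square)
  moreover have "0 \<le> (4.921556 - x\<^sub>0) * (16 * (x\<^sub>0 + 4.921556) - 98.82494)"
    using x0 by (intro mult_nonneg_nonneg) auto
  then have "K_const \<le> 98.82494"
    using x0 by (simp add: K' field_simps power2_eq_square)
  ultimately show "\<bar>K_const - 98.8249\<bar> < 0.00005"
    unfolding abs_less_iff by simp
qed

section \<open>Trees\<close>

text \<open>Acyclicity is recast as an order of construction in which each new vertex has exactly
  one earlier neighbour. Induction on this order is the one that the embedding needs. Only arcs into
  \<open>v\<close> are tested because the relation is symmetric wherever the predicate is
  used.\<close>

inductive leaf_built :: "('a \<times> 'a) set \<Rightarrow> 'a set \<Rightarrow> bool" for E where
  single: "leaf_built E {v}"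
| leaf: "leaf_built E (insert v A)"
  if "leaf_built E A" "v \<notin> A" "a \<in> A" "\<And>b. b \<in> A \<Longrightarrow> (b, v) \<in> E \<longleftrightarrow> b = a"

lemma leaf_built_finite: "leaf_built E A \<Longrightarrow> finite A"
  by (induction rule: leaf_built.induct) auto

lemma leaf_built_nonempty: "leaf_built E A \<Longrightarrow> A \<noteq> {}"
  by (induction rule: leaf_built.induct) auto

lemma (in wf_digraph) reachable_crossing:
  assumes "x \<rightarrow>\<^sup>* y" "x \<in> A" "y \<notin> A"
  shows "\<exists>a v. a \<in> A \<and> v \<notin> A \<and> (a, v) \<in> arcs_ends G"
  using assms by (induction rule: converse_reachable_induct) blast+

text \<open>Grow a vertex set from one vertex. Connectedness supplies an edge leaving the set, and a
  second edge from the set to the same new vertex would close a cycle.\<close>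

lemma undirected_tree_leaf_built:
  assumes "undirected_tree G"
  shows "leaf_built (parcs G) (pverts G)"
proof -
  interpret pair_graph G
    using assms by (simp add: undirected_tree_def)
  have sconn: "strongly_connected (with_proj G)"
    using assms sym_arcs symmetric_connected_imp_strongly_connected by (simp add: undirected_tree_def)
  have no_cycle: "\<not> (cycle p \<and> 3 \<le> length p)" for p
    using assms by (auto simp: undirected_tree_def)
  have sym: "(v, u) \<in> parcs G" if "(u, v) \<in> parcs G" for u v
    using that arcs_symmetric by blast
  \<comment> \<open>The invariant keeps connecting paths inside \<open>A\<close>, so that a path
    between two neighbours of the new vertex cannot pass through that vertex.\<close>
  define linked where
    "linked A \<longleftrightarrow> (\<forall>a\<in>A. \<forall>b\<in>A. \<exists>p. apath a p b \<and> set (pawalk_verts a p) \<subseteq> A)" for A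
  have "\<exists>A\<subseteq>pverts G. card A = Suc k \<and> leaf_built (parcs G) A \<and> linked A" if "Suc k \<le> card (pverts G)" for k
    using that
  proof (induction k)
    case 0
    then obtain v where v: "v \<in> pverts G"
      by (metis One_nat_def card.empty ex_in_conv not_one_le_zero)
    have "apath v [] v"
      using v by (simp add: apath_Nil_iff)
    then have "linked {v}"
      by (auto simp: linked_def intro!: exI[of _ "[]"])
    then show ?case
      using v by (intro exI[of _ "{v}"]) (auto intro: leaf_built.single)
  next
    case (Suc k)
    then obtain A where A: "A \<subseteq> pverts G" "card A = Suc k" "leaf_built (parcs G) A" "linked A"
      by auto
    have finA: "finite A"
      using A(3) by (rule leaf_built_finite)
    obtain x where x: "x \<in> A"
      using leaf_built_nonempty[OF A(3)] by blast
    obtain y where y: "y \<in> pverts G" "y \<notin> A"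
      using A Suc.prems by (metis Suc_n_not_le_n subsetI subset_antisym)
    have "x \<rightarrow>\<^sup>*\<^bsub>with_proj G\<^esub> y"
      using sconn x y A(1) by (auto simp: strongly_connected_def)
    then obtain a v where av: "a \<in> A" "v \<notin> A" "(a, v) \<in> parcs G"
      using reachable_crossing x y by blast
    have vG: "v \<in> pverts G"
      using av in_arcsD2 by blast
    have "b = a" if b: "b \<in> A" "(b, v) \<in> parcs G" for b
    proof (rule ccontr)
      assume "b \<noteq> a"
      obtain p where p: "apath a p b" "set (pawalk_verts a p) \<subseteq> A"
        using A(4) av(1) b(1) unfolding linked_def by blast
      then have p': "awalk a p b" "distinct (pawalk_verts a p)"
        by (auto simp: apath_def)
      have "p \<noteq> []"
        using p' \<open>b \<noteq> a\<close> by (auto simp: awalk_Nil_iff)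
      \<comment> \<open>From \<open>v\<close> to \<open>a\<close>, through \<open>A\<close> to
        \<open>b\<close>, and back to \<open>v\<close>. Because \<open>b\<close> differs from
        \<open>a\<close> the path has an arc, so this is a genuine cycle of length at least 3 and
        not an edge traversed back and forth.\<close>
      define q where "q = (v, a) # p @ [(b, v)]"
      have last: "awlast a p = b"
        using p'(1) by (auto simp: awalk_def dest: awlast_if_cas)
      have walk: "awalk a (p @ [(b, v)]) v"
        using p'(1) b(2) vG last by (auto simp: awalk_simps)
      then have q: "awalk v q v"
        unfolding q_def using sym[OF av(3)] by (simp only: awalk_Cons_iff append_Cons fst_conv snd_conv)
      have "pawalk_verts a (p @ [(b, v)]) = pawalk_verts a p @ [v]"
        using awalk_verts_append[OF walk] last by simp
      then have "cycle q"
        unfolding cycle_def using q p'(2) p(2) av(2) by (intro exI[of _ v]) (auto simp: q_def)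
      moreover have "3 \<le> length q"
        using \<open>p \<noteq> []\<close> by (cases p) (auto simp: q_def)
      ultimately show False
        using no_cycle by blast
    qed
    then have built: "leaf_built (parcs G) (insert v A)"
      using leaf_built.leaf[OF A(3) av(2,1)] av(3) by blast
    have "\<exists>p. apath s p t \<and> set (pawalk_verts s p) \<subseteq> insert v A"
      if st: "s \<in> insert v A" "t \<in> insert v A" for s t
    proof -
      consider "s = v" "t = v" | "s = v" "t \<in> A" | "s \<in> A" "t = v" | "s \<in> A" "t \<in> A"
        using st by blast
      then show ?thesis
      proof cases
        case 1
        then show ?thesis
          using vG by (intro exI[of _ "[]"]) (auto simp: apath_Nil_iff)
      next
        case 2
        then obtain p where "apath a p t" "set (pawalk_verts a p) \<subseteq> A"
          using 2 A(4) av(1) unfolding linked_def by blast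
        then show ?thesis
          using 2 sym[OF av(3)] av(2) by (intro exI[of _ "(v, a) # p"]) (auto simp: apath_Cons_iff)
      next
        case 3
        then obtain p where p: "apath s p a" "set (pawalk_verts s p) \<subseteq> A"
          using 3 A(4) av(1) unfolding linked_def by blast
        then have last: "awlast s p = a"
          by (auto simp: apath_def awalk_def dest: awlast_if_cas)
        then have path: "apath s (p @ [(a, v)]) t"
          using 3 p av vG by (auto simp: apath_append_iff apath_simps)
        then have "pawalk_verts s (p @ [(a, v)]) = pawalk_verts s p @ [v]"
          using last awalk_verts_append[of s p "[(a, v)]" t] by (simp add: apath_def)
        then show ?thesis
          using path p by (intro exI[of _ "p @ [(a, v)]"]) auto
      next
        case 4
        then show ?thesis
          using A(4) unfolding linked_def by blast
      qed
    qed
    then have "linked (insert v A)"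
      by (simp add: linked_def)
    then show ?case
      using built A finA vG av(2) by (intro exI[of _ "insert v A"]) auto
  qed
  \<comment> \<open>Connectedness includes nonemptiness, so the number of vertices has the form
    \<open>Suc k\<close> required above.\<close>
  moreover have "card (pverts G) \<noteq> 0"
    using sconn by (auto simp: strongly_connected_def)
  ultimately obtain A where A: "A \<subseteq> pverts G" "card A = card (pverts G)" "leaf_built (parcs G) A"
    by (metis Suc_pred' le_refl neq0_conv)
  then have "A = pverts G"
    by (simp add: card_subset_eq)
  then show ?thesis
    using A by simp
qed

text \<open>The function \<open>g\<close> bounds the sets in which all out-degrees, or all
  in-degrees, are at most \<open>d\<close>. Attaching a leaf to a copy with j vertices forbids at
  most j(c + 1) images, so degrees above that suffice. The sum is the total cost of the deletions,
  made for the last leaf first, and \<open>U\<close> is what is left of \<open>V\<close>.\<close>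

lemma leaf_built_embeds:
  fixes T :: "('b \<times> 'b) set" and R :: "('a \<times> 'a) set" and g :: "nat \<Rightarrow> real"
  assumes "leaf_built (T \<union> T\<inverse>) A"
    and asymT: "\<And>x y. (x, y) \<in> T \<Longrightarrow> (y, x) \<notin> T"
    and asymR: "\<And>x y. (x, y) \<in> R \<Longrightarrow> (y, x) \<notin> R"
    and fin: "finite V"
    and codeg: "\<And>x y. x \<in> V \<Longrightarrow> y \<in> V \<Longrightarrow> x \<noteq> y
      \<Longrightarrow> card {w \<in> V. (x, w) \<in> R \<union> R\<inverse> \<and> (y, w) \<in> R \<union> R\<inverse>} \<le> c"
    and sparse: "\<And>S d Q. S \<subseteq> V \<Longrightarrow> Q \<in> {R, R\<inverse>} \<Longrightarrow> (\<And>s. s \<in> S \<Longrightarrow> card {t \<in> S. (s, t) \<in> Q} \<le> d)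
      \<Longrightarrow> real (card S) \<le> g d"
    and "U \<subseteq> V" and "(\<Sum>j<card A. g (j * Suc c)) < card U"
  shows "\<exists>h. inj_on h A \<and> h ` A \<subseteq> U \<and> (\<forall>x\<in>A. \<forall>y\<in>A. (x, y) \<in> T \<longleftrightarrow> (h x, h y) \<in> R)"
  using assms(1,7,8)
proof (induction A arbitrary: U rule: leaf_built.induct)
  case (single v)
  \<comment> \<open>The empty set shows that the single summand \<open>g 0\<close> is nonnegative,
    which forces \<open>U\<close> to be nonempty.\<close>
  have "0 \<le> g 0"
    using sparse[of "{}" R 0] by simp
  then have "U \<noteq> {}"
    using single.prems by auto
  then obtain u where "u \<in> U"
    by blast
  then show ?case
    using asymT asymR by (intro exI[of _ "\<lambda>_. u"]) auto
next
  case (leaf A v a)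
  have finA: "finite A"
    using leaf.hyps(1) by (rule leaf_built_finite)
  define d where "d = card A * Suc c"
  define Q where "Q = (if (a, v) \<in> T then R else R\<inverse>)"
  have Q: "Q \<in> {R, R\<inverse>}" "Q \<union> Q\<inverse> = R \<union> R\<inverse>"
    by (auto simp: Q_def)
  \<comment> \<open>The vertices unfit to be the image of \<open>a\<close>: they have too few
    neighbours in the direction of the leaf. Degrees only drop on passing from \<open>U\<close> to
    \<open>S\<close>, so \<open>sparse\<close> applies to \<open>S\<close> itself.\<close>
  define S where "S = {s \<in> U. card {t \<in> U. (s, t) \<in> Q} \<le> d}"
  have finU: "finite U"
    using leaf.prems(1) fin by (rule finite_subset)
  have S: "S \<subseteq> U" "finite S"
    using finU by (auto simp: S_def)
  have "card {t \<in> S. (s, t) \<in> Q} \<le> d" if "s \<in> S" for s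
  proof -
    have "card {t \<in> S. (s, t) \<in> Q} \<le> card {t \<in> U. (s, t) \<in> Q}"
      using S finU by (intro card_mono) auto
    then show ?thesis
      using that by (auto simp: S_def)
  qed
  then have "real (card S) \<le> g d"
    using sparse[of S Q d] S leaf.prems(1) Q by blast
  moreover have "real (card (U - S)) = real (card U) - real (card S)"
    using S finU by (simp add: card_Diff_subset card_mono of_nat_diff)
  ultimately have "(\<Sum>j<card A. g (j * Suc c)) < card (U - S)"
    using leaf.prems(2) leaf.hyps(2) finA by (simp add: d_def)
  then obtain h where h: "inj_on h A" "h ` A \<subseteq> U - S"
      "\<forall>x\<in>A. \<forall>y\<in>A. (x, y) \<in> T \<longleftrightarrow> (h x, h y) \<in> R"
    using leaf.IH[of "U - S"] leaf.prems(1) by blast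
  \<comment> \<open>The forbidden images of \<open>v\<close>: the other vertices of the copy, and
    the neighbours of \<open>h a\<close> adjacent to one of them. Avoiding the latter makes the copy
    induced.\<close>
  define F where "F = (\<Union>u\<in>h ` A - {h a}. insert u {w \<in> V. (h a, w) \<in> R \<union> R\<inverse> \<and> (u, w) \<in> R \<union> R\<inverse>})"
  have hV: "h x \<in> V" if "x \<in> A" for x
    using h(2) that leaf.prems(1) by blast
  have "card F \<le> (\<Sum>u\<in>h ` A - {h a}. card (insert u {w \<in> V. (h a, w) \<in> R \<union> R\<inverse> \<and> (u, w) \<in> R \<union> R\<inverse>}))"
    unfolding F_def using finA by (intro card_UN_le) auto
  also have "\<dots> \<le> (\<Sum>u\<in>h ` A - {h a}. Suc c)"
  proof (rule sum_mono)
    fix u assume u: "u \<in> h ` A - {h a}"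
    have "card {w \<in> V. (h a, w) \<in> R \<union> R\<inverse> \<and> (u, w) \<in> R \<union> R\<inverse>} \<le> c"
      using u hV leaf.hyps(3) by (intro codeg) auto
    then show "card (insert u {w \<in> V. (h a, w) \<in> R \<union> R\<inverse> \<and> (u, w) \<in> R \<union> R\<inverse>}) \<le> Suc c"
      using fin by (simp add: card_insert_if)
  qed
  also have "\<dots> = card (h ` A - {h a}) * Suc c"
    by simp
  also have "\<dots> \<le> d"
    unfolding d_def using finA card_mono[of "h ` A" "h ` A - {h a}"] card_image_le[of A h]
    by (intro mult_right_mono) auto
  finally have cardF: "card F \<le> d" .
  \<comment> \<open>Only the copy of \<open>A\<close> has to avoid \<open>S\<close>; the new image
    is sought in all of \<open>U\<close>, where \<open>h a\<close> has more than \<open>d\<close>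
    neighbours in the right direction.\<close>
  have "h a \<in> U - S"
    using h(2) leaf.hyps(3) by blast
  then have "d < card {t \<in> U. (h a, t) \<in> Q}"
    by (auto simp: S_def)
  moreover have "finite F"
    using fin finA by (simp add: F_def)
  ultimately have "\<not> {t \<in> U. (h a, t) \<in> Q} \<subseteq> F"
    using cardF card_mono[of F "{t \<in> U. (h a, t) \<in> Q}"] by linarith
  then obtain w where w: "w \<in> U" "(h a, w) \<in> Q" "w \<notin> F"
    by blast
  have haw: "w \<noteq> h a"
    using w(2) asymR by (auto simp: Q_def split: if_splits)
  have wV: "w \<in> V"
    using w(1) leaf.prems(1) by blast
  have w_new: "w \<notin> h ` A"
    using w(3) haw by (auto simp: F_def)
  have w_nonadj: "(h x, w) \<notin> R" "(w, h x) \<notin> R" if "x \<in> A" "x \<noteq> a" for x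
  proof -
    have "h x \<in> h ` A - {h a}"
      using that h(1) leaf.hyps(3) by (auto dest: inj_onD)
    then have "(h x, w) \<notin> R \<union> R\<inverse>"
      using w(2,3) wV Q by (auto simp: F_def)
    then show "(h x, w) \<notin> R" "(w, h x) \<notin> R"
      by auto
  qed
  define h' where "h' = h(v := w)"
  have h'A: "h' x = h x" if "x \<in> A" for x
    using that leaf.hyps(2) by (auto simp: h'_def)
  have h'v: "h' v = w"
    by (simp add: h'_def)
  have T_v: "(a, v) \<in> T \<and> (v, a) \<notin> T \<or> (v, a) \<in> T \<and> (a, v) \<notin> T"
    using leaf.hyps(4)[OF leaf.hyps(3)] asymT by auto
  have arc_out: "(x, v) \<in> T \<longleftrightarrow> (h x, w) \<in> R" and arc_in: "(v, x) \<in> T \<longleftrightarrow> (w, h x) \<in> R" if "x \<in> A" for x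
  proof -
    have "((x, v) \<in> T \<longleftrightarrow> (h x, w) \<in> R) \<and> ((v, x) \<in> T \<longleftrightarrow> (w, h x) \<in> R)"
    proof (cases "x = a")
      case True
      then show ?thesis
        using T_v w(2) asymR by (auto simp: Q_def split: if_splits)
    next
      case False
      then show ?thesis
        using leaf.hyps(4)[OF that] w_nonadj[OF that] by auto
    qed
    then show "(x, v) \<in> T \<longleftrightarrow> (h x, w) \<in> R" "(v, x) \<in> T \<longleftrightarrow> (w, h x) \<in> R"
      by auto
  qed
  have "inj_on h' (insert v A)"
    using h(1) w_new leaf.hyps(2) by (auto simp: h'_def inj_on_def)
  moreover have "h' ` insert v A \<subseteq> U"
    using h(2) w(1) by (auto simp: h'_def)
  moreover have "(v, v) \<notin> T" "(w, w) \<notin> R"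
    using asymT asymR by blast+
  then have "\<forall>x\<in>insert v A. \<forall>y\<in>insert v A. (x, y) \<in> T \<longleftrightarrow> (h' x, h' y) \<in> R"
    using h(3) arc_in arc_out h'A h'v by simp
  ultimately show ?case
    by blast
qed

section \<open>Random graphs\<close>

text \<open>Expectation over the random subset of \<open>E\<close> that contains each element independently with probability \<open>p\<close>.\<close>

definition mean :: "'e set \<Rightarrow> real \<Rightarrow> ('e set \<Rightarrow> real) \<Rightarrow> real" where
  "mean E p g = (\<Sum>F\<in>Pow E. p ^ card F * (1 - p) ^ card (E - F) * g F)"

lemma mean_mono:
  assumes "0 \<le> p" "p \<le> 1" "\<And>F. F \<subseteq> E \<Longrightarrow> g F \<le> h F"
  shows "mean E p g \<le> mean E p h"
  unfolding mean_def using assms by (intro sum_mono mult_left_mono) auto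

lemma mean_add: "mean E p (\<lambda>F. g F + h F) = mean E p g + mean E p h"
  by (simp add: mean_def distrib_left sum.distrib)

lemma mean_cmult: "mean E p (\<lambda>F. c * g F) = c * mean E p g"
  by (simp add: mean_def sum_distrib_left mult.left_commute)

lemma mean_sum: "mean E p (\<lambda>F. \<Sum>i\<in>I. g i F) = (\<Sum>i\<in>I. mean E p (g i))"
  by (simp add: mean_def sum_distrib_left sum.swap[of _ I])

text \<open>The generating function of a binomial variable: weights and integrand factor over the
  elements of \<open>E\<close>, so the sum over subsets is an expanded product.\<close>

lemma mean_power_card:
  assumes "finite E" "B \<subseteq> E"
  shows "mean E p (\<lambda>F. y ^ card (F \<inter> B)) = (1 - p + p * y) ^ card B"
proof -
  have prod_y: "(\<Prod>e\<in>X. if e \<in> B then y else 1) = y ^ card (X \<inter> B)" if "finite X" for X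
    using that by (simp add: prod.If_cases Int_def)
  have "mean E p (\<lambda>F. y ^ card (F \<inter> B)) =
      (\<Sum>X\<in>Pow E. (\<Prod>e\<in>X. p * (if e \<in> B then y else 1)) * (\<Prod>e\<in>E-X. 1 - p))"
    unfolding mean_def using assms(1)
    by (intro sum.cong refl) (simp add: prod.distrib prod_y finite_subset del: if_distrib)
  also have "\<dots> = (\<Prod>e\<in>E. p * (if e \<in> B then y else 1) + (1 - p))"
    using assms(1) by (rule prod_add[symmetric])
  also have "\<dots> = (\<Prod>e\<in>B. p * (if e \<in> B then y else 1) + (1 - p))"
    using assms by (intro prod.mono_neutral_right) auto
  also have "\<dots> = (1 - p + p * y) ^ card B"
    by (simp add: algebra_simps)
  finally show ?thesis .
qed

text \<open>Giving weight 0 to the omission of an element of \<open>B\<close> encodes the indicator,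
  and the sum over subsets again becomes a product.\<close>

lemma mean_superset:
  assumes "finite E" "B \<subseteq> E"
  shows "mean E p (\<lambda>F. of_bool (B \<subseteq> F)) = p ^ card B"
proof -
  have "(\<Prod>e\<in>E-X. if e \<in> B then 0 else 1 - p) = of_bool (B \<subseteq> X) * (1 - p) ^ card (E - X)"
    if "X \<subseteq> E" for X
  proof (cases "B \<subseteq> X")
    case True
    then have "(\<Prod>e\<in>E-X. if e \<in> B then 0 else 1 - p) = (\<Prod>e\<in>E-X. 1 - p)"
      by (intro prod.cong) auto
    then show ?thesis
      using True by simp
  next
    case False
    then obtain e where "e \<in> B" "e \<notin> X"
      by blast
    then have "\<exists>e\<in>E-X. (if e \<in> B then 0 else 1 - p) = 0"
      using assms(2) by (intro bexI[of _ e]) auto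
    then show ?thesis
      using False assms(1) by (simp add: prod_zero_iff)
  qed
  then have "mean E p (\<lambda>F. of_bool (B \<subseteq> F)) =
      (\<Sum>X\<in>Pow E. (\<Prod>e\<in>X. p) * (\<Prod>e\<in>E-X. if e \<in> B then 0 else 1 - p))"
    unfolding mean_def by (intro sum.cong refl) simp
  also have "\<dots> = (\<Prod>e\<in>E. p + (if e \<in> B then 0 else 1 - p))"
    using assms(1) by (rule prod_add[symmetric])
  also have "\<dots> = (\<Prod>e\<in>B. p + (if e \<in> B then 0 else 1 - p))"
    using assms by (intro prod.mono_neutral_right) auto
  also have "\<dots> = p ^ card B"
    by simp
  finally show ?thesis .
qed

text \<open>The events \<open>B w \<subseteq> F\<close> are independent because the sets are
  disjoint. Independence is replaced by algebra: write x^count as the product of 1 + (x - 1) times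
  the indicators, expand over subsets of \<open>W\<close>, average each term by
  \<open>mean_superset\<close>, and refold.\<close>

lemma mean_power_disjoint:
  assumes "finite E" "finite W" "\<And>w. w \<in> W \<Longrightarrow> B w \<subseteq> E \<and> card (B w) = k"
    and "disjoint_family_on B W"
  shows "mean E p (\<lambda>F. x ^ card {w \<in> W. B w \<subseteq> F}) = (1 + (x - 1) * p ^ k) ^ card W"
proof -
  have card_Un: "card (\<Union>w\<in>U. B w) = k * card U" if "U \<subseteq> W" for U
  proof -
    have "card (\<Union>w\<in>U. B w) = (\<Sum>w\<in>U. card (B w))"
      using that assms by (intro card_UN_disjoint') (auto intro: disjoint_family_on_mono dest: finite_subset)
    also have "\<dots> = (\<Sum>w\<in>U. k)"
      using that assms(3) by (intro sum.cong) auto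
    finally show ?thesis
      by simp
  qed
  have expand: "x ^ card {w \<in> W. B w \<subseteq> F} =
      (\<Sum>U\<in>Pow W. (x - 1) ^ card U * of_bool ((\<Union>w\<in>U. B w) \<subseteq> F))" for F
  proof -
    have "x ^ card {w \<in> W. B w \<subseteq> F} = (\<Prod>w\<in>W. if B w \<subseteq> F then x else 1)"
      using assms(2) by (simp add: prod.If_cases Int_def)
    also have "\<dots> = (\<Prod>w\<in>W. (x - 1) * of_bool (B w \<subseteq> F) + 1)"
      by (intro prod.cong) auto
    also have "\<dots> = (\<Sum>U\<in>Pow W. (\<Prod>w\<in>U. (x - 1) * of_bool (B w \<subseteq> F)) * (\<Prod>w\<in>W-U. 1))"
      using assms(2) by (rule prod_add)
    also have "\<dots> = (\<Sum>U\<in>Pow W. (x - 1) ^ card U * of_bool ((\<Union>w\<in>U. B w) \<subseteq> F))"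
    proof (intro sum.cong refl)
      fix U assume "U \<in> Pow W"
      then have "finite U"
        using assms(2) finite_subset by auto
      then have "(\<Prod>w\<in>U. of_bool (B w \<subseteq> F)) = (of_bool ((\<Union>w\<in>U. B w) \<subseteq> F) :: real)"
        by (induction U rule: finite_induct) auto
      then show "(\<Prod>w\<in>U. (x - 1) * of_bool (B w \<subseteq> F)) * (\<Prod>w\<in>W-U. 1)
          = (x - 1) ^ card U * of_bool ((\<Union>w\<in>U. B w) \<subseteq> F)"
        by (simp add: prod.distrib)
    qed
    finally show ?thesis .
  qed
  have "mean E p (\<lambda>F. x ^ card {w \<in> W. B w \<subseteq> F})
      = (\<Sum>U\<in>Pow W. (x - 1) ^ card U * mean E p (\<lambda>F. of_bool ((\<Union>w\<in>U. B w) \<subseteq> F)))"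
    unfolding expand mean_sum mean_cmult ..
  also have "\<dots> = (\<Sum>U\<in>Pow W. (\<Prod>w\<in>U. (x - 1) * p ^ k) * (\<Prod>w\<in>W-U. 1))"
  proof (intro sum.cong refl)
    fix U assume U: "U \<in> Pow W"
    then have "(\<Union>w\<in>U. B w) \<subseteq> E"
      using assms(3) by blast
    then have "mean E p (\<lambda>F. of_bool ((\<Union>w\<in>U. B w) \<subseteq> F)) = p ^ (k * card U)"
      using U assms(1) card_Un by (simp add: mean_superset)
    then show "(x - 1) ^ card U * mean E p (\<lambda>F. of_bool ((\<Union>w\<in>U. B w) \<subseteq> F))
        = (\<Prod>w\<in>U. (x - 1) * p ^ k) * (\<Prod>w\<in>W-U. 1)"
      by (simp add: power_mult power_mult_distrib)
  qed
  also have "\<dots> = (\<Prod>w\<in>W. (x - 1) * p ^ k + 1)"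
    using assms(2) by (rule prod_add[symmetric])
  finally show ?thesis
    by (simp add: add.commute)
qed

lemma mean_less_one_witness:
  assumes "finite E" "0 \<le> p" "p \<le> 1" "mean E p g < 1"
  shows "\<exists>F\<subseteq>E. g F < 1"
proof (rule ccontr)
  assume "\<not> ?thesis"
  then have "mean E p (\<lambda>F. 1) \<le> mean E p g"
    using assms by (intro mean_mono) auto
  moreover have "mean E p (\<lambda>F. 1) = 1"
    using mean_superset[of E "{}" p] assms(1) by simp
  ultimately show False
    using assms(4) by simp
qed

lemma choose_two_real: "real (n choose 2) = real n * (real n - 1) / 2"
  by (induction n) (auto simp: numeral_2_eq_2 field_simps)

text \<open>Exponential Markov inequality with a union bound: \<open>g1\<close> and
  \<open>g2\<close> are sums of nonnegative penalties, each at least 1 when its bad event occurs.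
  Their total mean is below 1, so some \<open>F\<close> avoids all bad events.\<close>

lemma exists_pseudorandom_graph:
  fixes N :: nat and p s\<^sub>0 :: real
  defines "E \<equiv> {e \<in> Pow {..<N}. card e = 2}"
  assumes p: "0 \<le> p" "p \<le> 1"
    and codeg: "real N ^ 2 * exp (- 4 * real N * p\<^sup>2) \<le> 1 / 2"
    and s0: "1 \<le> s\<^sub>0" "800 * ln (4 * real N) \<le> p * (s\<^sub>0 - 1)"
  shows "\<exists>F\<subseteq>E.
    (\<forall>u<N. \<forall>v<N. u \<noteq> v \<longrightarrow> card {w \<in> {..<N} - {u, v}. {u, w} \<in> F \<and> {v, w} \<in> F} \<le> 5 * real N * p\<^sup>2) \<and>
    (\<forall>S\<subseteq>{..<N}. s\<^sub>0 \<le> card S \<longrightarrow> 88 / 100 * p * real (card S choose 2) \<le> card {e \<in> F. e \<subseteq> S})"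
proof (cases "N = 0")
  case True
  then show ?thesis
    using s0(1) by (intro exI[of _ "{}"]) auto
next
  case False
  define V where "V = {..<N}"
  define \<mu> where "\<mu> = real N * p\<^sup>2"
  \<comment> \<open>A common neighbour is a pair of edges contained in \<open>F\<close>; these pairs
    are disjoint for different \<open>w\<close>, as \<open>mean_power_disjoint\<close>
    requires.\<close>
  define cd where "cd F u v = card {w \<in> V - {u, v}. {{u, w}, {v, w}} \<subseteq> F}" for F u v
  define m where "m S = real (card S choose 2)" for S :: "nat set"
  define P where "P = {(u, v) \<in> V \<times> V. u \<noteq> v}"
  define \<S> where "\<S> = {S \<in> Pow V. s\<^sub>0 \<le> card S}"
  define g1 where "g1 F = (\<Sum>(u, v)\<in>P. exp (- 5 * \<mu> * ln 5) * 5 ^ cd F u v)" for F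
  define g2 where "g2 F = (\<Sum>S\<in>\<S>. exp (88 / 1000 * p * m S) * exp (- 1 / 10) ^ card (F \<inter> {e \<in> E. e \<subseteq> S}))" for F
  have finE: "finite E"
    by (simp add: E_def)
  have finV: "finite V" "card V = N"
    by (simp_all add: V_def)
  have finP: "finite P" and fin\<S>: "finite \<S>"
    using finV by (auto simp: P_def \<S>_def intro: finite_subset[of _ "V \<times> V"])
  have cardP: "card P \<le> N ^ 2"
    using card_mono[of "V \<times> V" P] finV by (auto simp: P_def card_cartesian_product power2_eq_square)
  have "mean E p g1 \<le> 1 / 2"
  proof -
    have "mean E p (\<lambda>F. 5 ^ cd F u v) \<le> exp (4 * \<mu>)" if uv: "(u, v) \<in> P" for u v
    proof -
      have "mean E p (\<lambda>F. 5 ^ cd F u v) = (1 + (5 - 1) * p ^ 2) ^ card (V - {u, v})"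
        unfolding cd_def
      proof (rule mean_power_disjoint)
        show "{{u, w}, {v, w}} \<subseteq> E \<and> card {{u, w}, {v, w}} = 2" if "w \<in> V - {u, v}" for w
          using uv that by (auto simp: P_def E_def V_def doubleton_eq_iff)
        show "disjoint_family_on (\<lambda>w. {{u, w}, {v, w}}) (V - {u, v})"
          by (auto simp: disjoint_family_on_def doubleton_eq_iff)
      qed (use finE finV in auto)
      also have "\<dots> \<le> (1 + 4 * p\<^sup>2) ^ N"
        using finV card_mono[of V "V - {u, v}"] by (auto intro!: power_increasing)
      also have "\<dots> \<le> exp (4 * p\<^sup>2) ^ N"
        by (intro power_mono exp_ge_add_one_self) auto
      also have "\<dots> = exp (4 * \<mu>)"
        by (simp add: \<mu>_def exp_of_nat_mult[symmetric] mult_ac)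
      finally show ?thesis .
    qed
    then have "mean E p g1 \<le> (\<Sum>(u, v)\<in>P. exp (- 5 * \<mu> * ln 5) * exp (4 * \<mu>))"
      unfolding g1_def case_prod_unfold mean_sum mean_cmult by (intro sum_mono mult_left_mono) auto
    also have "\<dots> = card P * exp (4 * \<mu> - 5 * \<mu> * ln 5)"
      by (simp add: exp_diff exp_minus field_simps)
    \<comment> \<open>Since ln 5 >= 8/5, the Chernoff exponent 4 - 5 ln 5 is at most -4. For a
      general deviation factor x it is -(1 - x + x ln x), the denominator of \<open>K_fun\<close>; 5
      is the minimiser rounded.\<close>
    also have "\<dots> \<le> card P * exp (- 4 * \<mu>)"
    proof -
      have "\<mu> * (8 / 5) \<le> \<mu> * ln 5"
        using ln_5_bounds(1) by (intro mult_left_mono) (auto simp: \<mu>_def)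
      then show ?thesis
        by (intro mult_left_mono) auto
    qed
    also have "\<dots> \<le> real N ^ 2 * exp (- 4 * \<mu>)"
      using cardP by (intro mult_right_mono) (simp_all flip: of_nat_power)
    finally show ?thesis
      using codeg by (simp add: \<mu>_def mult.assoc)
  qed
  moreover have "mean E p g2 < 1 / 2"
  proof -
    \<comment> \<open>Chosen so that the penalties of all nonempty sets sum to at most (1 + t)^N - 1
      <= exp (1/4) - 1, which is below 1/2.\<close>
    define t where "t = 1 / (4 * real N)"
    have t: "0 < t" "exp (- ln (4 * real N)) = t"
      using False by (simp_all add: t_def exp_minus inverse_eq_divide)
    have "exp (88 / 1000 * p * m S) * mean E p (\<lambda>F. exp (- 1 / 10) ^ card (F \<inter> {e \<in> E. e \<subseteq> S})) \<le> t ^ card S"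
      if S: "S \<in> \<S>" for S
    proof -
      have finS: "finite S"
        using S finV by (auto simp: \<S>_def intro: finite_subset)
      have "{e \<in> E. e \<subseteq> S} = {e. e \<subseteq> S \<and> card e = 2}"
        using S by (auto simp: \<S>_def E_def V_def)
      then have card_ES: "real (card {e \<in> E. e \<subseteq> S}) = m S"
        using finS by (simp add: n_subsets m_def)
      have "(11 / 10 :: real) \<le> exp (1 / 10)"
        using exp_ge_add_one_self[of "1 / 10 :: real"] by simp
      then have y: "exp (- 1 / 10) \<le> (10 / 11 :: real)"
        by (simp add: exp_minus field_simps)
      have "mean E p (\<lambda>F. exp (- 1 / 10) ^ card (F \<inter> {e \<in> E. e \<subseteq> S}))
          = (1 - p + p * exp (- 1 / 10)) ^ card {e \<in> E. e \<subseteq> S}"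
        using finE by (intro mean_power_card) auto
      also have "\<dots> \<le> exp (- p / 11) ^ card {e \<in> E. e \<subseteq> S}"
      proof (intro power_mono)
        have "1 - p + p * exp (- 1 / 10) \<le> 1 - p + p * (10 / 11)"
          using y p by (intro add_left_mono mult_left_mono) auto
        also have "\<dots> = 1 + (- p / 11)"
          by simp
        also have "\<dots> \<le> exp (- p / 11)"
          by (rule exp_ge_add_one_self)
        finally show "1 - p + p * exp (- 1 / 10) \<le> exp (- p / 11)" .
      qed (use p in auto)
      also have "\<dots> = exp (- p / 11 * m S)"
        by (simp add: exp_of_nat_mult[symmetric] card_ES mult_ac)
      finally have "exp (88 / 1000 * p * m S) * mean E p (\<lambda>F. exp (- 1 / 10) ^ card (F \<inter> {e \<in> E. e \<subseteq> S}))
          \<le> exp (88 / 1000 * p * m S) * exp (- p / 11 * m S)"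
        by (intro mult_left_mono) auto
      \<comment> \<open>The lower tail uses weight exp (-1/10) per edge, and 1/11 - 88/1000 exceeds
        1/400. As \<open>m S\<close> is card S (card S - 1)/2, the 400 becomes the 800 in the
        hypothesis on \<open>s\<^sub>0\<close>.\<close>
      also have "\<dots> \<le> exp (- (p * m S / 400))"
      proof -
        have "0 \<le> p * m S"
          using p by (simp add: m_def)
        then show ?thesis
          by (simp add: exp_add[symmetric])
      qed
      also have "\<dots> \<le> exp (real (card S) * (- ln (4 * real N)))"
      proof -
        have "800 * ln (4 * real N) \<le> p * (real (card S) - 1)"
          using s0(2) S p by (smt (verit) mem_Collect_eq \<S>_def mult_left_mono)
        then have "real (card S) * (800 * ln (4 * real N)) \<le> real (card S) * (p * (real (card S) - 1))"
          by (intro mult_left_mono) auto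
        then show ?thesis
          by (simp add: m_def choose_two_real algebra_simps)
      qed
      also have "\<dots> = t ^ card S"
        unfolding exp_of_nat_mult t(2) ..
      finally show ?thesis .
    qed
    then have "mean E p g2 \<le> (\<Sum>S\<in>\<S>. t ^ card S)"
      unfolding g2_def mean_sum mean_cmult by (intro sum_mono) auto
    also have "\<dots> \<le> (\<Sum>S\<in>Pow V - {{}}. t ^ card S)"
      using finV t s0(1) by (intro sum_mono2) (auto simp: \<S>_def)
    also have "\<dots> = (\<Sum>S\<in>Pow V. t ^ card S) - 1"
      using finV by (subst sum_diff1) auto
    also have "(\<Sum>S\<in>Pow V. t ^ card S) = (1 + t) ^ N"
      using prod_add[of V "\<lambda>_. t" "\<lambda>_. 1"] finV by (simp add: add.commute)
    also have "(1 + t) ^ N \<le> exp t ^ N"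
      using t by (intro power_mono exp_ge_add_one_self) auto
    also have "\<dots> = exp (1 / 4)"
      using False by (simp add: t_def exp_of_nat_mult[symmetric])
    also have "\<dots> \<le> 1 + 1 / 4 + (1 / 4)\<^sup>2"
      by (rule exp_bound) auto
    finally show ?thesis
      by (simp add: power2_eq_square)
  qed
  ultimately have "mean E p (\<lambda>F. g1 F + g2 F) < 1"
    by (simp add: mean_add)
  then obtain F where F: "F \<subseteq> E" "g1 F + g2 F < 1"
    using mean_less_one_witness[OF finE p] by blast
  have nonneg: "0 \<le> g1 F" "0 \<le> g2 F"
    by (auto simp: g1_def g2_def intro!: sum_nonneg)
  have "card {w \<in> {..<N} - {u, v}. {u, w} \<in> F \<and> {v, w} \<in> F} \<le> 5 * real N * p\<^sup>2"
    if uv: "u < N" "v < N" "u \<noteq> v" for u v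
  proof (rule ccontr)
    assume "\<not> ?thesis"
    then have gt: "5 * \<mu> < real (cd F u v)"
      by (simp add: cd_def V_def \<mu>_def mult.assoc)
    have "(u, v) \<in> P"
      using uv by (simp add: P_def V_def)
    then have "exp (- 5 * \<mu> * ln 5) * 5 ^ cd F u v \<le> g1 F"
      unfolding g1_def using finP member_le_sum[of "(u, v)" P "\<lambda>(u, v). exp (- 5 * \<mu> * ln 5) * 5 ^ cd F u v"]
      by auto
    moreover have "exp (- 5 * \<mu> * ln 5) * 5 ^ cd F u v = exp (ln 5 * (cd F u v - 5 * \<mu>))"
      by (simp add: exp_diff exp_minus right_diff_distrib exp_of_nat_mult field_simps)
    moreover have "1 \<le> exp (ln 5 * (real (cd F u v) - 5 * \<mu>))"
      using gt by simp
    ultimately show False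
      using F(2) nonneg by linarith
  qed
  moreover have "88 / 100 * p * real (card S choose 2) \<le> card {e \<in> F. e \<subseteq> S}"
    if S: "S \<subseteq> {..<N}" "s\<^sub>0 \<le> card S" for S
  proof (rule ccontr)
    assume "\<not> ?thesis"
    moreover have FS: "F \<inter> {e \<in> E. e \<subseteq> S} = {e \<in> F. e \<subseteq> S}"
      using F(1) by auto
    ultimately have gt: "real (card (F \<inter> {e \<in> E. e \<subseteq> S})) < 88 / 100 * p * m S"
      by (simp add: m_def)
    have "S \<in> \<S>"
      using S by (simp add: \<S>_def V_def)
    then have "exp (88 / 1000 * p * m S) * exp (- 1 / 10) ^ card (F \<inter> {e \<in> E. e \<subseteq> S}) \<le> g2 F"
      unfolding g2_def using fin\<S>
        member_le_sum[of S \<S> "\<lambda>S. exp (88 / 1000 * p * m S) * exp (- 1 / 10) ^ card (F \<inter> {e \<in> E. e \<subseteq> S})"]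
      by auto
    moreover have "exp (88 / 1000 * p * m S) * exp (- 1 / 10) ^ card (F \<inter> {e \<in> E. e \<subseteq> S})
        = exp (88 / 1000 * p * m S + card (F \<inter> {e \<in> E. e \<subseteq> S}) * (- 1 / 10))"
      by (simp only: exp_add exp_of_nat_mult)
    moreover have "1 \<le> exp (88 / 1000 * p * m S + card (F \<inter> {e \<in> E. e \<subseteq> S}) * (- 1 / 10))"
      using gt by simp
    ultimately show False
      using F(2) nonneg by linarith
  qed
  ultimately show ?thesis
    using F(1) by blast
qed

section \<open>The Ramsey bound\<close>

lemma orientation_of_underlying:
  assumes "orientation_of D G" "pair_graph G"
  shows "parcs D \<union> (parcs D)\<inverse> = parcs G"
proof -
  interpret pair_graph G
    by (rule assms(2))
  have "(a, b) \<in> parcs D \<union> (parcs D)\<inverse> \<longleftrightarrow> (a, b) \<in> parcs G" for a b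
    using assms(1) arcs_symmetric unfolding orientation_of_def by blast
  then show ?thesis
    by (simp add: set_eq_iff split_paired_all)
qed

lemma orientation_of_asym: "orientation_of D G \<Longrightarrow> (a, b) \<in> parcs D \<Longrightarrow> (b, a) \<notin> parcs D"
  unfolding orientation_of_def by blast

text \<open>Every edge inside a set is oriented, so a dense set has a large average out-degree and
  in-degree. This yields the function \<open>g\<close> of the embedding lemma, and
  \<open>large\<close> says that the deletions do not exhaust the N vertices.\<close>

lemma oriented_ramsey_trees_le_if_pseudorandom:
  fixes N n :: nat and p s\<^sub>0 :: real
  assumes p: "0 < p" "p \<le> 1" and s0: "0 \<le> s\<^sub>0"
    and F: "F \<subseteq> {e \<in> Pow {..<N}. card e = 2}"
    and codeg: "\<And>u v. u < N \<Longrightarrow> v < N \<Longrightarrow> u \<noteq> v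
      \<Longrightarrow> card {w \<in> {..<N} - {u, v}. {u, w} \<in> F \<and> {v, w} \<in> F} \<le> 5 * real N * p\<^sup>2"
    and dense: "\<And>S. S \<subseteq> {..<N} \<Longrightarrow> s\<^sub>0 \<le> card S
      \<Longrightarrow> 88 / 100 * p * real (card S choose 2) \<le> card {e \<in> F. e \<subseteq> S}"
    and large: "real n * (s\<^sub>0 + 1) + (5 * real N * p\<^sup>2 + 1) * (real n)\<^sup>2 / (88 / 100 * p) < real N"
  shows "oriented_ramsey (oriented_trees n) \<le> enat N"
proof -
  define G where "G = \<lparr>pverts = {..<N}, parcs = {(u, v). {u, v} \<in> F}\<rparr>"
  have edge: "u < N \<and> v < N \<and> u \<noteq> v" if "{u, v} \<in> F" for u v
    using that F by (auto simp: card_insert_if split: if_splits)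
  have graph: "pair_graph G"
  proof
    show "finite (parcs G)"
      by (rule finite_subset[of _ "{..<N} \<times> {..<N}"]) (auto simp: G_def dest: edge)
    show "symmetric (with_proj G)"
      by (auto simp: G_def symmetric_def sym_def insert_commute)
  qed (auto simp: G_def dest: edge)
  have "arrows G T" if T: "T \<in> oriented_trees n" for T
    unfolding arrows_def
  proof (intro allI impI)
    fix D assume D: "orientation_of D G"
    obtain H where H: "undirected_tree H" "orientation_of T H" and card_T: "card (pverts T) = n"
      using T by (auto simp: oriented_trees_def oriented_tree_def)
    have H_graph: "pair_graph H"
      using H(1) by (simp add: undirected_tree_def)
    define R where "R = parcs D"
    have R: "(u, v) \<in> R \<union> R\<inverse> \<longleftrightarrow> {u, v} \<in> F" for u v
      unfolding R_def orientation_of_underlying[OF D graph] by (simp add: G_def)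
    have T_edges: "parcs T \<union> (parcs T)\<inverse> = parcs H"
      using H(2) H_graph by (rule orientation_of_underlying)
    have asym_T: "(y, x) \<notin> parcs T" if "(x, y) \<in> parcs T" for x y
      using H(2) that by (rule orientation_of_asym)
    have asym_R: "(y, x) \<notin> R" if "(x, y) \<in> R" for x y
      using orientation_of_asym[OF D] that by (simp add: R_def)
    define c where "c = nat \<lfloor>5 * real N * p\<^sup>2\<rfloor>"
    have c: "real c \<le> 5 * real N * p\<^sup>2"
      by (simp add: c_def)
    \<comment> \<open>For large sets, 0.88 p (card S choose 2) <= d card S gives card S <= 1 +
      d/(0.44 p); the summand \<open>s\<^sub>0\<close> covers the sets too small for
      \<open>dense\<close>.\<close>
    define g where "g d = s\<^sub>0 + 1 + real d / (44 / 100 * p)" for d :: nat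
    have "\<exists>h. inj_on h (pverts T) \<and> h ` pverts T \<subseteq> {..<N} \<and>
        (\<forall>x\<in>pverts T. \<forall>y\<in>pverts T. (x, y) \<in> parcs T \<longleftrightarrow> (h x, h y) \<in> R)"
    proof (rule leaf_built_embeds[where V = "{..<N}" and c = c and g = g])
      show "leaf_built (parcs T \<union> (parcs T)\<inverse>) (pverts T)"
        using undirected_tree_leaf_built[OF H(1)] T_edges H(2) by (simp add: orientation_of_def)
      show "card {w \<in> {..<N}. (x, w) \<in> R \<union> R\<inverse> \<and> (y, w) \<in> R \<union> R\<inverse>} \<le> c"
        if "x \<in> {..<N}" "y \<in> {..<N}" "x \<noteq> y" for x y
      proof -
        have "{w \<in> {..<N}. (x, w) \<in> R \<union> R\<inverse> \<and> (y, w) \<in> R \<union> R\<inverse>}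
            = {w \<in> {..<N} - {x, y}. {x, w} \<in> F \<and> {y, w} \<in> F}"
          unfolding R by (auto dest: edge)
        then show ?thesis
          using codeg[of x y] that by (simp add: c_def le_nat_floor)
      qed
      show "real (card S) \<le> g d" if S: "S \<subseteq> {..<N}" and Q: "Q \<in> {R, R\<inverse>}"
        and d: "\<And>s. s \<in> S \<Longrightarrow> card {t \<in> S. (s, t) \<in> Q} \<le> d" for S d Q
      proof (cases "S \<noteq> {} \<and> s\<^sub>0 \<le> card S")
        case False
        then have "real (card S) \<le> s\<^sub>0"
          using s0 by auto
        moreover have "0 \<le> real d / (44 / 100 * p)"
          using p by simp
        ultimately show ?thesis
          by (simp add: g_def)
      next
        case True
        have finS: "finite S"
          using S finite_subset by blast
        \<comment> \<open>Each edge inside \<open>S\<close> is charged to the first endpoint of its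
          \<open>Q\<close>-arc, so the edges number at most the sum of the
          \<open>Q\<close>-degrees.\<close>
        have "{e \<in> F. e \<subseteq> S} \<subseteq> (\<lambda>(s, t). {s, t}) ` (SIGMA s:S. {t \<in> S. (s, t) \<in> Q})"
        proof
          fix e assume e: "e \<in> {e \<in> F. e \<subseteq> S}"
          then obtain s t where st: "e = {s, t}"
            using F by (auto simp: card_2_iff)
          then have "(s, t) \<in> R \<union> R\<inverse>"
            using e by (simp only: R mem_Collect_eq)
          then have "(s, t) \<in> Q \<or> (t, s) \<in> Q"
            using Q by auto
          then show "e \<in> (\<lambda>(s, t). {s, t}) ` (SIGMA s:S. {t \<in> S. (s, t) \<in> Q})"
          proof
            assume "(s, t) \<in> Q"
            then show ?thesis
              using e st by (intro image_eqI[of _ _ "(s, t)"]) auto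
          next
            assume "(t, s) \<in> Q"
            then show ?thesis
              using e st by (intro image_eqI[of _ _ "(t, s)"]) auto
          qed
        qed
        then have "card {e \<in> F. e \<subseteq> S} \<le> card (SIGMA s:S. {t \<in> S. (s, t) \<in> Q})"
          using finS by (intro surj_card_le) auto
        also have "\<dots> = (\<Sum>s\<in>S. card {t \<in> S. (s, t) \<in> Q})"
          using finS by simp
        also have "\<dots> \<le> (\<Sum>s\<in>S. d)"
          using d by (rule sum_mono)
        finally have "real (card {e \<in> F. e \<subseteq> S}) \<le> real (card S) * real d"
          by (simp flip: of_nat_mult)
        then have "88 / 100 * p * real (card S choose 2) \<le> real (card S) * real d"
          using dense[OF S] True by linarith
        then have "real (card S) * (44 / 100 * p * (real (card S) - 1)) \<le> real (card S) * real d"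
          by (simp add: choose_two_real algebra_simps)
        moreover have "0 < real (card S)"
          using True finS by (simp add: card_gt_0_iff)
        ultimately have "44 / 100 * p * (real (card S) - 1) \<le> real d"
          by (simp only: mult_le_cancel_left_pos)
        then have "real (card S) - 1 \<le> real d / (44 / 100 * p)"
          using p by (simp add: field_simps)
        then show ?thesis
          using s0 by (simp add: g_def)
      qed
      \<comment> \<open>Summing the linear growth of the deletions, instead of using the largest one
        n times, gains the factor 2.\<close>
      have sum_id: "(\<Sum>j<n. real j) \<le> (real n)\<^sup>2 / 2"
        by (induction n) (auto simp: power2_eq_square field_simps)
      have "g (j * Suc c) = s\<^sub>0 + 1 + real j * ((real c + 1) / (44 / 100 * p))" for j
        by (simp add: g_def algebra_simps)
      then have "(\<Sum>j<n. g (j * Suc c)) = real n * (s\<^sub>0 + 1) + (\<Sum>j<n. real j) * ((real c + 1) / (44 / 100 * p))"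
        by (simp only: sum.distrib sum_distrib_right) (simp add: distrib_left)
      also have "\<dots> = real n * (s\<^sub>0 + 1) + (real c + 1) * (\<Sum>j<n. real j) / (44 / 100 * p)"
        by simp
      also have "\<dots> \<le> real n * (s\<^sub>0 + 1) + (5 * real N * p\<^sup>2 + 1) * ((real n)\<^sup>2 / 2) / (44 / 100 * p)"
        using c p by (intro add_left_mono divide_right_mono mult_mono sum_id) (auto intro: sum_nonneg)
      also have "\<dots> < real N"
        using large by (simp add: field_simps)
      finally show "(\<Sum>j<card (pverts T). g (j * Suc c)) < card {..<N}"
        by (simp add: card_T)
    qed (use asym_T asym_R in auto)
    then show "\<exists>f. induced_copy f T D"
      using D by (auto simp: induced_copy_def orientation_of_def G_def R_def)
  qed
  then have "oriented_ramsey (oriented_trees n) \<le> enat (card (pverts G))"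
    unfolding oriented_ramsey_def arrows_class_def using graph by (intro INF_lower) auto
  then show ?thesis
    by (simp add: G_def)
qed

text \<open>With p = 0.16/n^2 the main deletion cost 5Np^2 n^2/(0.88 p) is exactly 10N/11. The other
  costs have order n^3 ln n and n^4, so they fit into the remaining N/11 for large n.\<close>

lemma oriented_ramsey_trees_le:
  "\<forall>\<^sub>F n in sequentially. ereal_of_enat (oriented_ramsey (oriented_trees n)) \<le> ereal (98 * real n ^ 4 * ln (real n))"
proof -
  define p where "p n = 16 / 100 / (real n)\<^sup>2" for n
  define N where "N n = nat \<lfloor>98 * real n ^ 4 * ln (real n)\<rfloor>" for n
  \<comment> \<open>Here 5000 = 800/0.16 makes p(s - 1) equal to 800 times the logarithm, and 400
    exceeds 4 * 98, so that logarithm dominates ln (4N).\<close>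
  define s\<^sub>0 where "s\<^sub>0 n = 1 + 5000 * (real n)\<^sup>2 * ln (400 * real n ^ 4 * ln (real n))" for n
  have N_le: "real (N n) \<le> 98 * real n ^ 4 * ln (real n)" if "1 \<le> n" for n
    using that by (simp add: N_def)
  have N_ge: "98 * real n ^ 4 * ln (real n) - 1 \<le> real (N n)" for n
    unfolding N_def by linarith
  have ev1: "\<forall>\<^sub>F n in sequentially. 98\<^sup>2 * (ln (real n))\<^sup>2 / (real n)\<^sup>2 \<le> 1 / 2"
    by real_asymp
  have ev2: "\<forall>\<^sub>F n in sequentially. 3 \<le> ln (real n)"
    by real_asymp
  have ev3: "\<forall>\<^sub>F n in sequentially. real n * (1 + 5000 * (real n)\<^sup>2 * ln (400 * real n ^ 4 * ln (real n)) + 1)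
      + (real n)\<^sup>2 / (88 / 100 * (16 / 100 / (real n)\<^sup>2)) < 9 / 100 * (98 * real n ^ 4 * ln (real n) - 1)"
    by real_asymp
  show ?thesis
    using ev1 ev2 ev3 eventually_ge_at_top[of 1]
  proof eventually_elim
    case (elim n)
    have "1 \<le> (real n)\<^sup>2"
      using elim(4) by simp
    then have "16 / 100 \<le> 1 * (real n)\<^sup>2"
      by linarith
    then have p: "0 < p n" "p n \<le> 1"
      using elim(4) by (simp_all only: p_def pos_divide_le_eq zero_less_power2) auto
    have M: "2 \<le> 98 * real n ^ 4 * ln (real n)"
    proof -
      have "1 * 1 \<le> real n ^ 4 * ln (real n)"
        using elim(2,4) by (intro mult_mono) auto
      then show ?thesis
        by linarith
    qed
    then have "1 \<le> 400 * real n ^ 4 * ln (real n)"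
      by linarith
    then have s0: "1 \<le> s\<^sub>0 n"
      unfolding s\<^sub>0_def by (simp only: le_add_same_cancel1) (intro mult_nonneg_nonneg ln_ge_zero, auto)
    \<comment> \<open>Rounding down costs at most 1, which is at most n^4 ln n / 3, whence 97 + 2/3.
      Then 4 (97 + 2/3) 0.16^2 is just above 10, and n^(-10) beats the factor N^2 of order n^8 (ln
      n)^2.\<close>
    have exponent: "10 * ln (real n) \<le> 4 * real (N n) * (p n)\<^sup>2"
    proof -
      have "1 \<le> real n ^ 4"
        using elim(4) by simp
      then have "1 \<le> real n ^ 4 * ln (real n) / 3"
        using elim(2) mult_mono[of 1 "real n ^ 4" 3 "ln (real n)"] by simp
      then have "(97 + 2 / 3) * real n ^ 4 * ln (real n) \<le> real (N n)"
        using N_ge[of n] by simp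
      then have "4 * ((97 + 2 / 3) * real n ^ 4 * ln (real n)) * (p n)\<^sup>2 \<le> 4 * real (N n) * (p n)\<^sup>2"
        by (intro mult_right_mono mult_left_mono) auto
      moreover have "4 * ((97 + 2 / 3) * real n ^ 4 * ln (real n)) * (p n)\<^sup>2 = 4 * (97 + 2 / 3) * (16 / 100)\<^sup>2 * ln (real n)"
        using elim(4) by (simp add: p_def power_divide flip: power_mult)
      moreover have "10 * ln (real n) \<le> 4 * (97 + 2 / 3) * (16 / 100)\<^sup>2 * ln (real n)"
        using elim(2) by (simp add: power2_eq_square)
      ultimately show ?thesis
        by linarith
    qed
    have "exp (- (4 * real (N n) * (p n)\<^sup>2)) \<le> exp (- (10 * ln (real n)))"
      using exponent by simp
    also have "\<dots> = 1 / real n ^ 10"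
      using elim(4) exp_of_nat_mult[of 10 "ln (real n)"] by (simp add: exp_minus inverse_eq_divide)
    finally have "real (N n) ^ 2 * exp (- (4 * real (N n) * (p n)\<^sup>2))
        \<le> (98 * real n ^ 4 * ln (real n)) ^ 2 * (1 / real n ^ 10)"
      using N_le[OF elim(4)] by (intro mult_mono power_mono) auto
    also have "\<dots> = 98\<^sup>2 * (ln (real n))\<^sup>2 / (real n)\<^sup>2"
      using elim(4) by (simp add: power_mult_distrib field_simps flip: power_mult power_add)
    finally have codeg: "real (N n) ^ 2 * exp (- 4 * real (N n) * (p n)\<^sup>2) \<le> 1 / 2"
      using elim(1) by simp
    have ln_N: "ln (4 * real (N n)) \<le> ln (400 * real n ^ 4 * ln (real n))"
    proof (rule ln_mono)
      show "0 < 4 * real (N n)"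
        using M N_ge[of n] by linarith
      show "4 * real (N n) \<le> 400 * real n ^ 4 * ln (real n)"
        using M N_le[OF elim(4)] by linarith
    qed
    have "800 * ln (4 * real (N n)) \<le> p n * (s\<^sub>0 n - 1)"
      using ln_N elim(4) by (simp add: p_def s\<^sub>0_def)
    then obtain F where F: "F \<subseteq> {e \<in> Pow {..<N n}. card e = 2}"
      "\<forall>u<N n. \<forall>v<N n. u \<noteq> v \<longrightarrow> card {w \<in> {..<N n} - {u, v}. {u, w} \<in> F \<and> {v, w} \<in> F} \<le> 5 * real (N n) * (p n)\<^sup>2"
      "\<forall>S\<subseteq>{..<N n}. s\<^sub>0 n \<le> card S \<longrightarrow> 88 / 100 * p n * real (card S choose 2) \<le> card {e \<in> F. e \<subseteq> S}"
      using exists_pseudorandom_graph[OF less_imp_le[OF p(1)] p(2) codeg s0] by auto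
    \<comment> \<open>Uses 10/11 + 9/100 < 1.\<close>
    have less: "a + (10 / 11 * x + b) < x" if "a + b < c" "c \<le> 9 / 100 * x" "0 \<le> x" for a b c x :: real
      using that by linarith
    have "(5 * real (N n) * (p n)\<^sup>2 + 1) * (real n)\<^sup>2 / (88 / 100 * p n)
        = 10 / 11 * real (N n) + (real n)\<^sup>2 / (88 / 100 * p n)"
      using elim(4) by (simp add: p_def field_simps power2_eq_square)
    moreover have "real n * (s\<^sub>0 n + 1) + (10 / 11 * real (N n) + (real n)\<^sup>2 / (88 / 100 * p n)) < real (N n)"
    proof (rule less)
      show "real n * (s\<^sub>0 n + 1) + (real n)\<^sup>2 / (88 / 100 * p n) < 9 / 100 * (98 * real n ^ 4 * ln (real n) - 1)"
        using elim(3) by (simp only: s\<^sub>0_def p_def)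
      show "9 / 100 * (98 * real n ^ 4 * ln (real n) - 1) \<le> 9 / 100 * real (N n)"
        using N_ge[of n] by (rule mult_left_mono) simp
    qed simp
    ultimately have "real n * (s\<^sub>0 n + 1) + (5 * real (N n) * (p n)\<^sup>2 + 1) * (real n)\<^sup>2 / (88 / 100 * p n) < real (N n)"
      by (simp only:)
    then have "oriented_ramsey (oriented_trees n) \<le> enat (N n)"
      using p s0 F by (intro oriented_ramsey_trees_le_if_pseudorandom[where p = "p n" and s\<^sub>0 = "s\<^sub>0 n" and F = F]) auto
    then have "ereal_of_enat (oriented_ramsey (oriented_trees n)) \<le> ereal (real (N n))"
      by (metis ereal_of_enat_le_iff ereal_of_enat_simps(1))
    then show ?case
      using N_le[OF elim(4)] order_trans by fastforce
  qed
qed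

theorem theorem4p7:
  shows "(\<exists>x>1. K_fun x = K_const \<and> (\<forall>y>1. K_const \<le> K_fun y))
    \<and> \<bar>K_const - 98.8249\<bar> < 0.00005
    \<and> (\<forall>\<epsilon>::real. \<epsilon> > 0 \<longrightarrow> (\<exists>n\<^sub>\<epsilon>::nat. \<forall>n\<ge>n\<^sub>\<epsilon>.
          ereal_of_enat (oriented_ramsey (oriented_trees n))
            < ereal ((K_const + \<epsilon>) * real n ^ 4 * ln (real n))))
    \<and> (\<exists>N::nat. \<forall>n\<ge>N.
          ereal_of_enat (oriented_ramsey (oriented_trees n))
            < ereal (99 * real n ^ 4 * ln (real n)))"
proof (intro conjI allI impI)
  show "\<exists>x>1. K_fun x = K_const \<and> (\<forall>y>1. K_const \<le> K_fun y)"
    and K: "\<bar>K_const - 98.8249\<bar> < 0.00005"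
    by (rule K_const_minimum)+
  \<comment> \<open>Both asymptotic claims need only a leading constant above 98; for n >= 2 the
    factor n^4 ln n is positive, which makes the inequality strict.\<close>
  have bound: "\<exists>n\<^sub>0. \<forall>n\<ge>n\<^sub>0. ereal_of_enat (oriented_ramsey (oriented_trees n)) < ereal (c * real n ^ 4 * ln (real n))"
    if "98 < c" for c
  proof -
    have "\<forall>\<^sub>F n in sequentially. ereal_of_enat (oriented_ramsey (oriented_trees n)) < ereal (c * real n ^ 4 * ln (real n))"
      using oriented_ramsey_trees_le eventually_ge_at_top[of 2]
    proof eventually_elim
      case (elim n)
      have "98 * (real n ^ 4 * ln (real n)) < c * (real n ^ 4 * ln (real n))"
        using elim(2) that by (intro mult_strict_right_mono) auto
      then show ?case
        using elim(1) by (intro le_less_trans[OF elim(1)]) (simp add: mult.assoc)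
    qed
    then show ?thesis
      by (simp add: eventually_sequentially)
  qed
  have "98 < K_const"
    using K unfolding abs_less_iff by simp
  then show "\<exists>n\<^sub>\<epsilon>. \<forall>n\<ge>n\<^sub>\<epsilon>. ereal_of_enat (oriented_ramsey (oriented_trees n))
      < ereal ((K_const + \<epsilon>) * real n ^ 4 * ln (real n))" if "0 < \<epsilon>" for \<epsilon> :: real
    using that by (intro bound) simp
  show "\<exists>N. \<forall>n\<ge>N. ereal_of_enat (oriented_ramsey (oriented_trees n)) < ereal (99 * real n ^ 4 * ln (real n))"
    by (intro bound) simp
qed

end
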